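(* For Lebesgue almost every $\lambda\in(0,1/2]$ the set $K_\lambda\setminus\{0,1\}$ contains only irrational numbers.
   Context: For $\lambda\in(0,1/2]$, $K_\lambda\subset\mathbb{R}$ is the self-similar set generated by the iterated function system $\{f_{\lambda,d}(x)=\lambda x+d(1-\lambda): d=0,1\}$, i.e. the unique nonempty compact set with $K_\lambda=f_{\lambda,0}(K_\lambda)\cup f_{\lambda,1}(K_\lambda)$; equivalently $K_\lambda=\{(1-\lambda)\sum_{n=1}^\infty i_n\lambda^{n-1}: i_n\in\{0,1\}\ \forall n\ge 1\}$. *)

theory Defs
  imports "HOL-Analysis.Analysis"
begin

definition ifs_map :: "real \<Rightarrow> real \<Rightarrow> real \<Rightarrow> real" where
  "ifs_map lam d x = lam * x + d * (1 - lam)"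

definition is_self_similar_set :: "real \<Rightarrow> real set \<Rightarrow> bool" where
  "is_self_similar_set lam K \<longleftrightarrow>
     K \<noteq> {} \<and> compact K \<and> K = ifs_map lam 0 ` K \<union> ifs_map lam 1 ` K"

text \<open>The description operator is meaningful only where existence and uniqueness hold; this is
  proved for all parameters strictly between 0 and 1 in \<open>ex1_self_similar_set\<close> below.\<close>

definition self_similar_set :: "real \<Rightarrow> real set" where
  "self_similar_set lam = (THE K. is_self_similar_set lam K)"

lemma ex_self_similar_set:
  assumes "0 < lam" "lam < 1"
  shows "\<exists>K. is_self_similar_set lam K"
proof -
  define F where "F A = ifs_map lam 0 ` A \<union> ifs_map lam 1 ` A" for A
  have F_mono: "A \<subseteq> B \<Longrightarrow> F A \<subseteq> F B" for A B by (auto simp: F_def)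
  define K where "K = \<Union>{A. A \<subseteq> {0..1} \<and> A \<subseteq> F A}"
  have K_upper: "A \<subseteq> K" if "A \<subseteq> {0..1}" "A \<subseteq> F A" for A
    using that by (auto simp: K_def)
  have K01: "K \<subseteq> {0..1}" by (auto simp: K_def)
  have KF: "K \<subseteq> F K"
  proof
    fix x assume "x \<in> K"
    then obtain A where A: "x \<in> A" "A \<subseteq> {0..1}" "A \<subseteq> F A" by (auto simp: K_def)
    then show "x \<in> F K" using F_mono[OF K_upper[OF A(2,3)]] by auto
  qed
  have F01: "F {0..1} \<subseteq> {0..1}"
  proof -
    have "lam * x + (1 - lam) \<le> 1" if "x \<le> 1" for x
      using that assms mult_left_mono[of x 1 lam] by simp
    moreover have "lam * x \<le> 1" if "0 \<le> x" "x \<le> 1" for x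
      using that assms by (intro mult_le_one) auto
    ultimately show ?thesis using assms by (auto simp: F_def ifs_map_def)
  qed
  have FK: "F K \<subseteq> K"
    using F01 F_mono[OF K01] F_mono[OF KF] by (intro K_upper) auto
  have cont: "continuous_on UNIV (ifs_map lam d)" for d
    unfolding ifs_map_def by (intro continuous_intros)
  have c: "compact (closure K)"
    using K01 by (meson bounded_subset compact_closure compact_Icc compact_imp_bounded)
  have "closed (F (closure K))"
    unfolding F_def
    by (intro closed_Un compact_imp_closed compact_continuous_image c continuous_on_subset[OF cont]) auto
  then have "closure K \<subseteq> F (closure K)"
    using KF F_mono[OF closure_subset[of K]] by (intro closure_minimal) auto
  moreover have "closure K \<subseteq> {0..1}" using K01 by (intro closure_minimal) auto
  ultimately have "closure K = K" using K_upper closure_subset by blast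
  then have "compact K" using c by simp
  moreover have "0 \<in> K" using K_upper[of "{0}"] by (auto simp: F_def ifs_map_def)
  ultimately show ?thesis
    using FK KF unfolding is_self_similar_set_def F_def by blast
qed

lemma self_similar_set_eq_series:
  assumes "0 < lam" "lam < 1" and K: "is_self_similar_set lam K"
  shows "K = {(1 - lam) * (\<Sum>n. i n * lam ^ n) | i :: nat \<Rightarrow> real. \<forall>n. i n \<in> {0, 1}}"
proof (intro equalityI subsetI)
  have Kne: "K \<noteq> {}" and Kcompact: "compact K"
    and Kmaps: "\<And>y d. y \<in> K \<Longrightarrow> d \<in> {0,1} \<Longrightarrow> ifs_map lam d y \<in> K"
    using K unfolding is_self_similar_set_def by blast+
  have pow0: "(\<lambda>n. lam ^ n) \<longlonglongrightarrow> 0" using assms by (intro LIMSEQ_realpow_zero) auto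
  {
    fix x assume "x \<in> K"
    have "\<forall>y\<in>K. \<exists>d z. d \<in> {0,1} \<and> z \<in> K \<and> y = ifs_map lam d z"
      using K unfolding is_self_similar_set_def by blast
    then obtain D Z where D: "\<And>y. y \<in> K \<Longrightarrow> D y \<in> {0,1}" and Z: "\<And>y. y \<in> K \<Longrightarrow> Z y \<in> K"
        and DZ: "\<And>y. y \<in> K \<Longrightarrow> ifs_map lam (D y) (Z y) = y"
      by metis
    define i where "i n = D ((Z ^^ n) x)" for n
    have ZK: "(Z ^^ n) x \<in> K" for n by (induction n) (use \<open>x \<in> K\<close> Z in auto)
    have i01: "i n \<in> {0,1}" for n using D[OF ZK] by (simp add: i_def)
    have step: "(Z ^^ n) x = lam * (Z ^^ Suc n) x + i n * (1 - lam)" for n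
      using DZ[OF ZK[of n], unfolded ifs_map_def, symmetric] unfolding i_def funpow.simps comp_def .
    have x: "x = (1 - lam) * (\<Sum>k<n. i k * lam ^ k) + lam ^ n * (Z ^^ n) x" for n
    proof (induction n)
      case (Suc n)
      have "lam ^ n * (Z ^^ n) x = lam ^ Suc n * (Z ^^ Suc n) x + (1 - lam) * (i n * lam ^ n)"
        by (subst step) (simp only: power_Suc algebra_simps)
      then have "(1 - lam) * (\<Sum>k<n. i k * lam ^ k) + lam ^ n * (Z ^^ n) x
          = (1 - lam) * (\<Sum>k<Suc n. i k * lam ^ k) + lam ^ Suc n * (Z ^^ Suc n) x"
        unfolding sum.lessThan_Suc distrib_left by linarith
      then show ?case using Suc.IH by (rule trans[rotated])
    qed simp
    obtain B where "\<And>y. y \<in> K \<Longrightarrow> norm y \<le> B"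
      using Kcompact by (meson compact_imp_bounded bounded_iff)
    then have "Bseq (\<lambda>n. (Z ^^ n) x)" using ZK by (intro BseqI') auto
    then have "(\<lambda>n. lam ^ n * (Z ^^ n) x) \<longlonglongrightarrow> 0"
      using pow0 unfolding tendsto_Zfun_iff by (simp add: bounded_bilinear.Zfun_prod_Bfun[OF bounded_bilinear_mult])
    then have "(\<lambda>n. (x - lam ^ n * (Z ^^ n) x) / (1 - lam)) \<longlonglongrightarrow> (x - 0) / (1 - lam)"
      using assms by (intro tendsto_intros) auto
    moreover have "(x - lam ^ n * (Z ^^ n) x) / (1 - lam) = (\<Sum>k<n. i k * lam ^ k)" for n
    proof -
      have "x - lam ^ n * (Z ^^ n) x = (1 - lam) * (\<Sum>k<n. i k * lam ^ k)"
        using x[of n] by linarith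
      then show ?thesis using assms(2) by simp
    qed
    ultimately have "(\<lambda>k. i k * lam ^ k) sums (x / (1 - lam))" by (simp add: sums_def)
    then have "x = (1 - lam) * (\<Sum>k. i k * lam ^ k)" using assms by (simp add: sums_iff)
    then show "x \<in> {(1 - lam) * (\<Sum>n. i n * lam ^ n) | i :: nat \<Rightarrow> real. \<forall>n. i n \<in> {0, 1}}"
      using i01 by blast
  next
    fix x assume "x \<in> {(1 - lam) * (\<Sum>n. i n * lam ^ n) | i :: nat \<Rightarrow> real. \<forall>n. i n \<in> {0, 1}}"
    then obtain i :: "nat \<Rightarrow> real" where i: "\<And>n. i n \<in> {0,1}"
      and x: "x = (1 - lam) * (\<Sum>n. i n * lam ^ n)" by blast
    obtain z where z: "z \<in> K" using Kne by blast
    have inK: "(1 - lam) * (\<Sum>k<n. j k * lam ^ k) + lam ^ n * z \<in> K"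
      if "\<And>n. j n \<in> {0,1}" for n and j :: "nat \<Rightarrow> real"
      using that
    proof (induction n arbitrary: j)
      case 0
      then show ?case using z by simp
    next
      case (Suc n)
      let ?y = "(1 - lam) * (\<Sum>k<n. j (Suc k) * lam ^ k) + lam ^ n * z"
      have "?y \<in> K" using Suc.IH[of "\<lambda>k. j (Suc k)"] Suc.prems by blast
      then have "ifs_map lam (j 0) ?y \<in> K"
        using Suc.prems[of 0] by (intro Kmaps)
      moreover have "ifs_map lam (j 0) ?y
          = (1 - lam) * (\<Sum>k<Suc n. j k * lam ^ k) + lam ^ Suc n * z"
        by (subst sum.lessThan_Suc_shift)
           (simp add: ifs_map_def algebra_simps sum_distrib_left)
      ultimately show ?case by simp
    qed
    have "summable (\<lambda>n. i n * lam ^ n)"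
    proof (rule summable_comparison_test')
      show "summable (\<lambda>n. lam ^ n)" using assms by (intro summable_geometric) auto
      show "norm (i n * lam ^ n) \<le> lam ^ n" if "n \<ge> 0" for n using i[of n] assms by auto
    qed
    then have lim: "(\<lambda>n. (1 - lam) * (\<Sum>k<n. i k * lam ^ k) + lam ^ n * z) \<longlonglongrightarrow> x + 0 * z"
      unfolding x by (intro tendsto_intros pow0 summable_LIMSEQ)
    have "x + 0 * z \<in> K"
      by (rule closed_sequentially[OF compact_imp_closed[OF Kcompact] _ lim]) (intro allI inK i)
    then show "x \<in> K" by simp
  }
qed

lemma ex1_self_similar_set:
  assumes "0 < lam" "lam < 1"
  shows "\<exists>!K. is_self_similar_set lam K"
proof (rule ex_ex1I[OF ex_self_similar_set[OF assms]])
  fix K L assume "is_self_similar_set lam K" "is_self_similar_set lam L"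
  then show "K = L"
    by (rule trans[OF self_similar_set_eq_series[OF assms] sym[OF self_similar_set_eq_series[OF assms]]])
qed

lemma is_self_similar_set_self_similar_set:
  assumes "0 < lam" "lam < 1"
  shows "is_self_similar_set lam (self_similar_set lam)"
  unfolding self_similar_set_def using ex1_self_similar_set[OF assms] by (rule theI')

end

theory Submission
  imports Defs
begin

text \<open>
  It suffices to show that a fixed point \<open>x\<close> with \<open>0 < x < 1\<close> lies in \<open>K\<^sub>\<lambda>\<close> only for a null set of
  parameters \<open>\<lambda>\<close>, because there are only countably many rational \<open>x\<close>; the single parameter
  \<open>\<lambda> = 1/2\<close>, for which \<open>K\<^sub>\<lambda>\<close> is the whole interval, is itself negligible.

  Fix \<open>x\<close> and \<open>b < 1/2\<close>, and let \<open>\<lambda> \<le> b\<close>. At level \<open>n\<close> the set \<open>K\<^sub>\<lambda>\<close> is covered by \<open>2\<^sup>n\<close> intervals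
  of length \<open>\<lambda>\<^sup>n\<close>, one for each word of \<open>n\<close> digits. A word is recorded as the set \<open>D\<close> of positions of
  its digits 1, and the left endpoint of its interval is \<open>\<Sum>k\<in>D. (1 - \<lambda>) \<lambda>\<^sup>k\<close>. The key point is
  transversality: for \<open>k \<ge> 1\<close> the function \<open>(1 - \<lambda>) \<lambda>\<^sup>k\<close> increases on \<open>[0, 1/2]\<close>, and on
  \<open>[0, b]\<close> its rate of growth is at least a fixed multiple of its own value
  (\<open>weighted_power_growth\<close>). So if the first digit is 0,
  the left endpoint of an interval containing \<open>x\<close> moves to the right as \<open>\<lambda>\<close> grows, at a rate of at
  least a fixed multiple of \<open>x\<close> up to an error \<open>O(b\<^sup>n)\<close>, and the interval,
  of length at most \<open>b\<^sup>n\<close>, contains \<open>x\<close> only while \<open>\<lambda>\<close> runs through a set of diameter \<open>O(b\<^sup>n)\<close>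
  (\<open>cylinder_parameters_close\<close>). A word with first digit 1 reduces to this case by the reflection
  \<open>x \<mapsto> 1 - x\<close>, which flips all digits. Altogether the parameters in question are covered by \<open>O(2\<^sup>n)\<close>
  intervals of length \<open>O(b\<^sup>n)\<close>, of total length \<open>O((2 b)\<^sup>n)\<close>, which tends to 0.
\<close>

section \<open>Cylinders\<close>

definition cylinder_left :: "nat set \<Rightarrow> real \<Rightarrow> real" where
  "cylinder_left D lam = (\<Sum>k\<in>D. (1 - lam) * lam ^ k)"

definition cylinder :: "nat \<Rightarrow> nat set \<Rightarrow> real \<Rightarrow> real set" where
  "cylinder n D lam = {cylinder_left D lam .. cylinder_left D lam + lam ^ n}"

lemma self_similar_set_cylinder:
  assumes lam: "0 < lam" "lam < 1" and x: "x \<in> self_similar_set lam"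
  obtains D where "D \<subseteq> {..<n}" "x \<in> cylinder n D lam"
proof -
  obtain i :: "nat \<Rightarrow> real" where i: "\<And>k. i k \<in> {0, 1}"
    and x_eq: "x = (1 - lam) * (\<Sum>k. i k * lam ^ k)"
    using x self_similar_set_eq_series[OF lam is_self_similar_set_self_similar_set[OF lam]] by blast
  have summable_pow: "summable (\<lambda>k. lam ^ k)"
    using lam by (intro summable_geometric) auto
  have le: "0 \<le> i k * lam ^ k" "i k * lam ^ k \<le> lam ^ k" for k
    using i[of k] lam by auto
  have summable_i: "summable (\<lambda>k. i k * lam ^ k)"
    by (rule summable_comparison_test'[OF summable_pow]) (use le in auto)
  define D where "D = {k. k < n \<and> i k = 1}"
  define tail where "tail = (\<Sum>k. i (k + n) * lam ^ (k + n))"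
  have "(\<Sum>k<n. i k * lam ^ k) = (\<Sum>k\<in>D. lam ^ k)"
    using i by (intro sum.mono_neutral_cong_right) (auto simp: D_def)
  then have x_split: "x = cylinder_left D lam + (1 - lam) * tail"
    unfolding x_eq tail_def suminf_split_initial_segment[OF summable_i, of n] cylinder_left_def
    by (simp add: distrib_left sum_distrib_left)
  have "0 \<le> tail"
    unfolding tail_def using le summable_ignore_initial_segment[OF summable_i]
    by (intro suminf_nonneg)
  moreover have "(1 - lam) * tail \<le> lam ^ n"
  proof -
    have "tail \<le> (\<Sum>k. lam ^ (k + n))"
      unfolding tail_def
      by (intro suminf_le le summable_ignore_initial_segment[OF summable_i]
          summable_ignore_initial_segment[OF summable_pow])
    also have "\<dots> = lam ^ n / (1 - lam)"
      using lam suminf_mult[OF summable_pow, of "lam ^ n"] suminf_geometric[of lam]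
      by (simp add: power_add mult.commute)
    finally show ?thesis
      using lam by (simp add: field_simps)
  qed
  ultimately have "x \<in> cylinder n D lam"
    using lam by (simp add: cylinder_def x_split)
  moreover have "D \<subseteq> {..<n}"
    by (auto simp: D_def)
  ultimately show thesis
    using that by blast
qed

lemma self_similar_set_subset_unit:
  assumes "0 < lam" "lam < 1"
  shows "self_similar_set lam \<subseteq> {0..1}"
proof
  fix x assume "x \<in> self_similar_set lam"
  from self_similar_set_cylinder[OF assms this, of 0] show "x \<in> {0..1}"
    by (auto simp: cylinder_def cylinder_left_def)
qed

text \<open>The two left endpoints add up to \<open>1 - \<lambda>\<^sup>n\<close>, by the geometric sum; hence the reflection
  \<open>x \<mapsto> 1 - x\<close> exchanges the cylinders of complementary words.\<close>

lemma cylinder_reflect: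
  assumes "D \<subseteq> {..<n}" "x \<in> cylinder n D lam"
  shows "1 - x \<in> cylinder n ({..<n} - D) lam"
proof -
  have "cylinder_left D lam + cylinder_left ({..<n} - D) lam = (\<Sum>k<n. (1 - lam) * lam ^ k)"
    unfolding cylinder_left_def
    using sum.subset_diff[OF assms(1), of "\<lambda>k. (1 - lam) * lam ^ k"] by simp
  also have "\<dots> = 1 - lam ^ n"
    by (simp add: sum_distrib_left[symmetric] one_diff_power_eq)
  finally show ?thesis
    using assms(2) by (auto simp: cylinder_def)
qed

section \<open>Transversality\<close>

text \<open>The case \<open>k = 1\<close> is \<open>\<mu>(1 - \<mu>) - \<lambda>(1 - \<lambda>) = (\<mu> - \<lambda>)(1 - \<mu> - \<lambda>)\<close>; the other powers only help.
  The growth is compared with the value at \<open>\<lambda>\<close> so that the bounds for different \<open>k\<close> add up to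
  one in terms of the left endpoint of a cylinder. The bound fails for \<open>k = 0\<close>, which is why the
  first digit has to be 0 below.\<close>

lemma weighted_power_growth:
  fixes lam mu b :: real
  assumes "0 < lam" "lam \<le> mu" "mu \<le> b" "b \<le> 1/2" "1 \<le> k"
  shows "(1 - 2 * b) * (mu - lam) * ((1 - lam) * lam ^ k) \<le> (1 - mu) * mu ^ k - (1 - lam) * lam ^ k"
proof -
  obtain j where k: "k = Suc j"
    using assms(5) by (cases k) auto
  have "(1 - lam) * lam \<le> 1"
    using assms by (intro mult_le_one) auto
  then have "(1 - 2 * b) * (mu - lam) * ((1 - lam) * lam) \<le> (1 - 2 * b) * (mu - lam)"
    using assms by (intro mult_left_le) auto
  also have "\<dots> \<le> (1 - mu - lam) * (mu - lam)"
    using assms by (intro mult_right_mono) auto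
  also have "\<dots> = (1 - mu) * mu - (1 - lam) * lam"
    by (simp add: algebra_simps)
  finally have "lam ^ j * ((1 - 2 * b) * (mu - lam) * ((1 - lam) * lam))
      \<le> lam ^ j * ((1 - mu) * mu - (1 - lam) * lam)"
    using assms by (intro mult_left_mono) auto
  moreover have "lam ^ j * ((1 - mu) * mu) \<le> mu ^ j * ((1 - mu) * mu)"
    using assms by (intro mult_right_mono power_mono) auto
  ultimately show ?thesis
    unfolding k by (simp add: algebra_simps)
qed

lemma cylinder_parameters_close:
  assumes D: "D \<subseteq> {1..<n}" and x: "0 < x" and b: "b < 1/2"
    and lam: "0 < lam" "lam \<le> mu" "mu \<le> b"
    and cyl: "x \<in> cylinder n D lam" "x \<in> cylinder n D mu"
  shows "mu - lam \<le> 2 * b ^ n / ((1 - 2 * b) * x)"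
proof -
  define c where "c = (1 - 2 * b) * (mu - lam)"
  have c: "0 \<le> c" "c \<le> 1"
    using lam b by (auto simp: c_def intro!: mult_le_one)
  have pow: "lam ^ n \<le> b ^ n"
    using lam by (intro power_mono) auto
  \<comment> \<open>\<open>x - lam ^ n\<close> is a lower bound for the left endpoint at \<open>lam\<close>, which in turn bounds its growth.\<close>
  have "c * (x - lam ^ n) \<le> c * cylinder_left D lam"
    using cyl(1) c by (intro mult_left_mono) (auto simp: cylinder_def)
  also have "\<dots> \<le> cylinder_left D mu - cylinder_left D lam"
    unfolding cylinder_left_def c_def sum_distrib_left sum_subtractf[symmetric]
    using D lam b by (intro sum_mono weighted_power_growth) auto
  also have "\<dots> \<le> lam ^ n"
    using cyl by (auto simp: cylinder_def)
  finally have "c * x \<le> lam ^ n + c * lam ^ n"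
    by (simp add: algebra_simps)
  also have "\<dots> \<le> 2 * lam ^ n"
    using c mult_right_mono[of c 1 "lam ^ n"] lam by simp
  also have "\<dots> \<le> 2 * b ^ n"
    using pow by simp
  finally show ?thesis
    using b x by (simp add: c_def field_simps)
qed

section \<open>Null sets of parameters\<close>

text \<open>At level \<open>n\<close> there are at most \<open>2\<^sup>n\<close> words with first digit 0, each contributing an interval
  around one of its parameters whose radius is the bound of \<open>cylinder_parameters_close\<close>.\<close>

lemma cylinder_parameters_cover:
  assumes x: "0 < x" and b: "0 < b" "b < 1/2"
  obtains T where "T \<in> lmeasurable"
    "{lam \<in> {0<..b}. \<exists>D\<subseteq>{1..<n}. x \<in> cylinder n D lam} \<subseteq> T"
    "measure lebesgue T \<le> 4 / ((1 - 2 * b) * x) * (2 * b) ^ n"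
proof -
  define r where "r = 2 * b ^ n / ((1 - 2 * b) * x)"
  have r: "0 \<le> r"
    using x b by (simp add: r_def)
  define S where "S D = {lam \<in> {0<..b}. x \<in> cylinder n D lam}" for D
  \<comment> \<open>When \<open>S D\<close> is empty, \<open>p D\<close> is an arbitrary point, and its interval only adds to the cover.\<close>
  define p where "p D = (SOME lam. lam \<in> S D)" for D
  define I where "I D = {p D - r .. p D + r}" for D
  have S_I: "S D \<subseteq> I D" if D: "D \<subseteq> {1..<n}" for D
  proof
    fix lam assume lam: "lam \<in> S D"
    then have "p D \<in> S D"
      unfolding p_def by (rule someI)
    with lam cylinder_parameters_close[OF D x b(2), of lam "p D"]
      cylinder_parameters_close[OF D x b(2), of "p D" lam]
    have "\<bar>lam - p D\<bar> \<le> r"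
      using r by (cases "lam \<le> p D") (auto simp: S_def r_def)
    then show "lam \<in> I D"
      by (auto simp: I_def)
  qed
  define T where "T = (\<Union>D\<in>Pow {1..<n}. I D)"
  show thesis
  proof
    show "T \<in> lmeasurable"
      unfolding T_def I_def by (intro fmeasurable.finite_UN) auto
    show "{lam \<in> {0<..b}. \<exists>D\<subseteq>{1..<n}. x \<in> cylinder n D lam} \<subseteq> T"
    proof clarify
      fix lam D assume "lam \<in> {0<..b}" "D \<subseteq> {1..<n}" "x \<in> cylinder n D lam"
      then have "lam \<in> I D"
        using S_I[of D] by (auto simp: S_def)
      then show "lam \<in> T"
        using \<open>D \<subseteq> {1..<n}\<close> by (auto simp: T_def)
    qed
    have "measure lebesgue T \<le> (\<Sum>D\<in>Pow {1..<n}. measure lebesgue (I D))"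
      unfolding T_def I_def by (intro measure_UNION_le) auto
    also have "\<dots> = 2 ^ (n - 1) * (2 * r)"
      using r by (simp add: I_def card_Pow)
    also have "\<dots> \<le> 2 ^ n * (2 * r)"
      using r by (intro mult_right_mono power_increasing) auto
    also have "\<dots> = 4 / ((1 - 2 * b) * x) * (2 * b) ^ n"
      by (simp add: r_def power_mult_distrib)
    finally show "measure lebesgue T \<le> 4 / ((1 - 2 * b) * x) * (2 * b) ^ n" .
  qed
qed

lemma negligible_parameters_le:
  assumes x: "0 < x" "x < 1" and b: "0 < b" "b < 1/2"
  shows "negligible {lam \<in> {0<..b}. x \<in> self_similar_set lam}"
  unfolding negligible_outer_le
proof (intro allI impI)
  fix e :: real assume e: "0 < e"
  define C where "C y = 4 / ((1 - 2 * b) * y)" for y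
  have "(\<lambda>n. C x * (2 * b) ^ n + C (1 - x) * (2 * b) ^ n) \<longlonglongrightarrow> C x * 0 + C (1 - x) * 0"
    using b by (intro tendsto_intros LIMSEQ_realpow_zero) auto
  then have "\<forall>\<^sub>F n in sequentially. C x * (2 * b) ^ n + C (1 - x) * (2 * b) ^ n < e"
    using e by (intro order_tendstoD(2)) auto
  then obtain n where n: "C x * (2 * b) ^ n + C (1 - x) * (2 * b) ^ n < e"
    using eventually_happens trivial_limit_sequentially by blast
  define A where "A y = {lam \<in> {0<..b}. \<exists>D\<subseteq>{1..<n}. y \<in> cylinder n D lam}" for y
  obtain T where T: "T \<in> lmeasurable" "A x \<subseteq> T" "measure lebesgue T \<le> C x * (2 * b) ^ n"
    using cylinder_parameters_cover[OF x(1) b, of n] unfolding A_def C_def by blast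
  obtain U where U: "U \<in> lmeasurable" "A (1 - x) \<subseteq> U"
    "measure lebesgue U \<le> C (1 - x) * (2 * b) ^ n"
    using cylinder_parameters_cover[of "1 - x" b n] x b unfolding A_def C_def by auto
  have "{lam \<in> {0<..b}. x \<in> self_similar_set lam} \<subseteq> A x \<union> A (1 - x)"
  proof
    fix lam assume "lam \<in> {lam \<in> {0<..b}. x \<in> self_similar_set lam}"
    then have lam: "lam \<in> {0<..b}" and K: "x \<in> self_similar_set lam"
      by auto
    obtain D where D: "D \<subseteq> {..<n}" "x \<in> cylinder n D lam"
      using self_similar_set_cylinder[of lam x n] lam b K by auto
    show "lam \<in> A x \<union> A (1 - x)"
    proof (cases "0 \<in> D")
      case True
      then have "{..<n} - D \<subseteq> {1..<n}"
        by (auto simp: Suc_le_eq intro: gr0I)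
      then show ?thesis
        using cylinder_reflect[OF D] lam unfolding A_def by blast
    next
      case False
      then have "D \<subseteq> {1..<n}"
        using D(1) by (auto simp: Suc_le_eq intro: gr0I)
      then show ?thesis
        using D(2) lam unfolding A_def by blast
    qed
  qed
  then have "{lam \<in> {0<..b}. x \<in> self_similar_set lam} \<subseteq> T \<union> U"
    using T(2) U(2) by blast
  moreover have "T \<union> U \<in> lmeasurable"
    using T(1) U(1) by (rule fmeasurable.Un)
  moreover have "measure lebesgue (T \<union> U) \<le> e"
    using measure_Un_le[of T lebesgue U] T U n by (auto simp: fmeasurableD)
  ultimately show "\<exists>T. {lam \<in> {0<..b}. x \<in> self_similar_set lam} \<subseteq> T \<and> T \<in> lmeasurable
      \<and> measure lebesgue T \<le> e"
    by blast
qed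

lemma negligible_parameters:
  assumes x: "0 < x" "x < 1"
  shows "negligible {lam \<in> {0<..<1/2}. x \<in> self_similar_set lam}"
proof -
  define b :: "nat \<Rightarrow> real" where "b m = 1/2 - 1 / (real m + 3)" for m
  have b: "0 < b m" "b m < 1/2" for m
    by (auto simp: b_def field_simps)
  have "{lam \<in> {0<..<1/2}. x \<in> self_similar_set lam}
      \<subseteq> (\<Union>m. {lam \<in> {0<..b m}. x \<in> self_similar_set lam})"
  proof
    fix lam assume lam: "lam \<in> {lam \<in> {0<..<1/2}. x \<in> self_similar_set lam}"
    then obtain m where m: "inverse (real (Suc m)) < 1/2 - lam"
      using reals_Archimedean[of "1/2 - lam"] by auto
    have "1 / (real m + 3) \<le> inverse (real (Suc m))"
      by (simp add: field_simps)
    then have "lam \<le> b m"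
      using m unfolding b_def by linarith
    then show "lam \<in> (\<Union>m. {lam \<in> {0<..b m}. x \<in> self_similar_set lam})"
      using lam by auto
  qed
  moreover have "negligible (\<Union>m. {lam \<in> {0<..b m}. x \<in> self_similar_set lam})"
    using negligible_parameters_le[OF x b] by (intro negligible_countable_Union) auto
  ultimately show ?thesis
    using negligible_subset by blast
qed

theorem corollary1p3:
  shows "AE lam in lebesgue. lam \<in> {0<..1/2} \<longrightarrow> (\<forall>x \<in> self_similar_set lam - {0, 1}. x \<notin> \<rat>)"
proof -
  define N where "N = insert (1/2) (\<Union>x\<in>\<rat> \<inter> {0<..<1}. {lam \<in> {0<..<1/2}. x \<in> self_similar_set lam})"
  have "countable (\<rat> \<inter> {0<..<1::real})"
    using countable_rat by (rule countable_Int1)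
  then have "negligible N"
    unfolding N_def using negligible_parameters
    by (intro negligible_insert[THEN iffD2] negligible_countable_Union) auto
  then have "N \<in> null_sets lebesgue"
    by (simp add: negligible_iff_null_sets)
  moreover have "{lam \<in> space lebesgue. \<not> (lam \<in> {0<..1/2} \<longrightarrow>
      (\<forall>x \<in> self_similar_set lam - {0, 1}. x \<notin> \<rat>))} \<subseteq> N"
    (is "?bad \<subseteq> N")
  proof
    fix lam assume "lam \<in> ?bad"
    then obtain x where lam: "0 < lam" "lam \<le> 1/2"
      and x: "x \<in> self_similar_set lam" "x \<noteq> 0" "x \<noteq> 1" "x \<in> \<rat>"
      by auto
    have "x \<in> {0..1}"
      using self_similar_set_subset_unit[of lam] lam x(1) by auto
    then show "lam \<in> N"
      using lam x by (cases "lam = 1/2") (auto simp: N_def)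
  qed
  ultimately show ?thesis
    by (rule AE_I')
qed

end
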